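(* Let $\mathcal{H}$ be a real Hilbert space, $\gamma,\lambda>0$, $u_0,v_0\in\mathcal{H}$, and assume: (1) $\Psi:\mathcal{H}\to[0,+\infty)$ is convex and twice differentiable, $\nabla\Psi$ and $\nabla^2\Psi$ are Lipschitz continuous, and $\operatorname{argmin}\Psi=\Psi^{-1}(0)\neq\emptyset$; (2) $\Phi:\mathcal{H}\to\mathbb{R}$ is convex, twice differentiable and bounded from below, $\nabla\Phi$ and $\nabla^2\Phi$ are Lipschitz continuous, and $S:=\{z\in\operatorname{argmin}\Psi:\ \Phi(z)\le\Phi(x)\ \ \forall x\in\operatorname{argmin}\Psi\}\neq\emptyset$; (3) $\beta:[0,+\infty)\to(0,+\infty)$ is a $C^1$ function with $\lim_{t\to+\infty}\beta(t)=+\infty$ and $0\le\dot\beta(t)\le k\beta(t)$ for all $t\ge 0$, where $0<k<\frac{\theta}{1+\lambda\gamma}\min\left\{\frac{2\gamma}{3},\frac{2}{\lambda}\right\}$ for some $\theta\in(0,1)$; (4) for every $p\in\operatorname{ran}N_{\operatorname{argmin}\Psi}$, $$\int_0^{+\infty}\beta(t)\left[\Psi^*\left(\frac{p}{\beta(t)}\right)-\sigma_{\operatorname{argmin}\Psi}\left(\frac{p}{\beta(t)}\right)\right]dt<+\infty.$$ Let $x:[0,+\infty)\to\mathcal{H}$ be the strong global solution of $$\ddot x(t)+\gamma\dot x(t)+\lambda\nabla^2\Phi(x(t))(\dot x(t))+\lambda\beta(t)\nabla^2\Psi(x(t))(\dot x(t))+\nabla\Phi(x(t))+(\beta(t)+\lambda\dot\beta(t))\nabla\Psi(x(t))=0,$$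 $$x(0)=u_0,\quad \dot x(0)=v_0.$$ If $\Phi$ is strongly convex, then $x(t)$ converges strongly, as $t\to+\infty$, to the unique optimal solution of the problem $\inf_{y\in\operatorname{argmin}\Psi}\Phi(y)$ (that is, to the unique element of $S$).
   Context: $\nabla$ and $\nabla^2$ denote gradient and Hessian. $\operatorname{argmin}\Psi$ is the set of minimizers of $\Psi$ over $\mathcal{H}$. $\Psi^*(p)=\sup_{x\in\mathcal{H}}\{\langle p,x\rangle-\Psi(x)\}$ is the Fenchel conjugate of $\Psi$ (values in $\mathbb{R}\cup\{+\infty\}$). $\sigma_{\operatorname{argmin}\Psi}(p)=\sup_{x\in\operatorname{argmin}\Psi}\langle p,x\rangle$ is the support function. The normal cone is $N_{\operatorname{argmin}\Psi}(x)=\{p\in\mathcal{H}:\langle p,y-x\rangle\le 0\ \forall y\in\operatorname{argmin}\Psi\}$ for $x\in\operatorname{argmin}\Psi$ and $\emptyset$ otherwise; its range $\operatorname{ran}N_{\operatorname{argmin}\Psi}$ is the set of all $p$ with $p\in N_{\operatorname{argmin}\Psi}(x)$ for some $x\in\operatorname{argmin}\Psi$. Since $\Psi^*\ge\sigma_{\operatorname{argmin}\Psi}$, the integrand in (4) is nonnegative (with values in $[0,+\infty]$ wherever the support function is finite, which is the case for $p\in\operatorname{ran}N_{\operatorname{argmin}\Psi}$). A strong global solution is a function $x:[0,+\infty)\to\mathcal{H}$ such that $x$ and $\dot x$ are locally absolutely continuous (absolutely continuous on each $[0,b]$, $0<b<+\infty$), the initial conditions hold, and the differential equation holds for almost every $t\in[0,+\infty)$.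 Under the assumptions on $\Phi,\Psi,\beta$, existence and uniqueness of such a solution follow from the Cauchy-Lipschitz-Picard Theorem. Strongly convex means $\mu$-strongly convex for some $\mu>0$. *)

theory Defs
  imports "HOL-Analysis.Analysis"
begin

section \<open>Gradient and Hessian on a real Hilbert space\<close>

text \<open>
  A real Hilbert space is a type of sort \<open>{real_inner, complete_space}\<close>.  Differentiability is
  Frechet differentiability.  The two descriptions below are meaningful for differentiable
  functions: see \<open>GDERIV_grad\<close> and \<open>has_derivative_hessian\<close>.
\<close>

definition grad :: "('a::real_inner \<Rightarrow> real) \<Rightarrow> 'a \<Rightarrow> 'a" where
  "grad f x = (THE g. GDERIV f x :> g)"

definition hessian :: "('a::real_inner \<Rightarrow> real) \<Rightarrow> 'a \<Rightarrow> 'a \<Rightarrow>\<^sub>L 'a" where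
  "hessian f x = Blinfun (frechet_derivative (grad f) (at x))"

definition twice_differentiable :: "('a::real_inner \<Rightarrow> real) \<Rightarrow> bool" where
  "twice_differentiable f \<longleftrightarrow>
     (\<forall>x. f differentiable (at x)) \<and> (\<forall>x. grad f differentiable (at x))"

definition lipschitz_continuous :: "('a::metric_space \<Rightarrow> 'b::metric_space) \<Rightarrow> bool" where
  "lipschitz_continuous f \<longleftrightarrow> (\<exists>L. L-lipschitz_on UNIV f)"

lemma riesz_representation:
  fixes f :: "'a::{real_inner, complete_space} \<Rightarrow> real"
  assumes "bounded_linear f"
  obtains z where "\<And>y. f y = inner y z"
proof -
  interpret f: bounded_linear f by fact
  define J where "J x = (norm x)\<^sup>2 / 2 - f x" for x
  obtain K where K: "\<And>x. norm (f x) \<le> norm x * K" using f.bounded by blast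
  have lb: "- K\<^sup>2 / 2 \<le> J x" for x
  proof -
    have "f x \<le> norm x * K" using K[of x] by simp
    moreover have "0 \<le> (norm x - K)\<^sup>2" by simp
    ultimately show ?thesis unfolding J_def by (simp add: power2_diff)
  qed
  then have bdd: "bdd_below (range J)" by (intro bdd_belowI) auto
  define m where "m = Inf (range J)"
  have m: "m \<le> J x" for x unfolding m_def using bdd by (intro cInf_lower) auto
  have "\<exists>x. J x < m + inverse (real (Suc n))" for n
    using cInf_lessD[of "range J" "m + inverse (real (Suc n))"] unfolding m_def[symmetric]
    by (auto simp: inverse_positive_iff_positive)
  then obtain X where X: "\<And>n. J (X n) < m + inverse (real (Suc n))" by metis
  have par: "(norm (x - y))\<^sup>2 / 4 = J x + J y - 2 * J ((1/2) *\<^sub>R (x + y))" for x y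
    unfolding J_def power2_norm_eq_inner
    by (simp add: f.scaleR f.add inner_add inner_diff inner_commute algebra_simps add_divide_distrib diff_divide_distrib)
  have "Cauchy X"
  proof (rule metric_CauchyI)
    fix e :: real assume e: "e > 0"
    obtain N where N: "inverse (real (Suc N)) < e\<^sup>2 / 8"
      using reals_Archimedean[of "e\<^sup>2 / 8"] e by auto
    have "dist (X i) (X j) < e" if "i \<ge> N" "j \<ge> N" for i j
    proof -
      have "inverse (real (Suc i)) \<le> inverse (real (Suc N))"
           "inverse (real (Suc j)) \<le> inverse (real (Suc N))"
        using that by (auto intro!: le_imp_inverse_le)
      with X[of i] X[of j] N m[of "(1/2) *\<^sub>R (X i + X j)"] par[of "X i" "X j"]
      have "(norm (X i - X j))\<^sup>2 < e\<^sup>2" by linarith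
      then show ?thesis using e by (simp add: dist_norm power_less_imp_less_base)
    qed
    then show "\<exists>M. \<forall>i\<ge>M. \<forall>j\<ge>M. dist (X i) (X j) < e" by blast
  qed
  then obtain z where z: "X \<longlonglongrightarrow> z" using Cauchy_convergent convergent_def by blast
  have lim1: "(\<lambda>n. J (X n)) \<longlonglongrightarrow> J z"
    unfolding J_def by (intro tendsto_intros f.tendsto z) simp
  have lim2: "(\<lambda>n. m + inverse (real (Suc n))) \<longlonglongrightarrow> m + 0"
    by (intro tendsto_intros LIMSEQ_inverse_real_of_nat)
  have "J z \<le> m + 0"
    by (rule LIMSEQ_le[OF lim1 lim2]) (use X less_imp_le in blast)
  then have min: "J z \<le> J y" for y using m[of y] by simp
  have "f y = inner y z" for y
  proof -
    define a b where "a = inner y z - f y" and "b = (norm y)\<^sup>2"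
    have b0: "b \<ge> 0" unfolding b_def by simp
    have *: "0 \<le> t * a + t\<^sup>2 * b / 2" for t
      using min[of "z + t *\<^sub>R y"] unfolding J_def a_def b_def power2_norm_eq_inner
      by (simp add: f.scaleR f.add inner_add inner_commute algebra_simps power2_eq_square)
    have "a = 0"
    proof (rule ccontr)
      assume "a \<noteq> 0"
      define t where "t = - a / (b + 1)"
      have "t * a + t\<^sup>2 * b / 2 = - a\<^sup>2 * (b / 2 + 1) / (b + 1)\<^sup>2"
        unfolding t_def using b0 by (simp add: divide_simps) (simp add: power2_eq_square algebra_simps)
      also have "\<dots> < 0" using b0 \<open>a \<noteq> 0\<close> by (simp add: divide_neg_pos)
      finally show False using *[of t] by simp
    qed
    then show ?thesis unfolding a_def by simp
  qed
  then show thesis using that by blast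
qed

lemma GDERIV_unique:
  assumes "GDERIV f x :> g" "GDERIV f x :> g'" shows "g = g'"
proof -
  have "(\<lambda>h. inner h g) = (\<lambda>h. inner h g')"
    using assms unfolding gderiv_def by (rule has_derivative_unique)
  then have "inner (g - g') (g - g') = 0" by (metis inner_diff_right right_minus_eq)
  then show ?thesis by simp
qed

lemma grad_eqI: "GDERIV f x :> g \<Longrightarrow> grad f x = g"
  unfolding grad_def using GDERIV_unique by (intro the_equality)

lemma GDERIV_grad:
  fixes f :: "'a::{real_inner, complete_space} \<Rightarrow> real"
  assumes "f differentiable (at x)" shows "GDERIV f x :> grad f x"
proof -
  obtain D where D: "(f has_derivative D) (at x)" using assms unfolding differentiable_def by blast
  obtain z where "\<And>y. D y = inner y z"
    using riesz_representation[OF has_derivative_bounded_linear[OF D]] by blast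
  then have "D = (\<lambda>h. inner h z)" by blast
  with D have "GDERIV f x :> z" unfolding gderiv_def by simp
  then show ?thesis using grad_eqI by metis
qed

lemma has_derivative_hessian:
  assumes "grad f differentiable (at x)"
  shows "(grad f has_derivative blinfun_apply (hessian f x)) (at x)"
  using assms unfolding hessian_def
  by (simp add: bounded_linear_Blinfun_apply frechet_derivative_works has_derivative_bounded_linear)

section \<open>Convex analysis\<close>

definition strongly_convex :: "('a::real_inner \<Rightarrow> real) \<Rightarrow> bool" where
  "strongly_convex f \<longleftrightarrow>
     (\<exists>\<mu>>0. \<forall>x y. \<forall>t\<in>{0..1}.
        f ((1 - t) *\<^sub>R x + t *\<^sub>R y)
          \<le> (1 - t) * f x + t * f y - \<mu> / 2 * t * (1 - t) * (norm (x - y))\<^sup>2)"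

definition argmin_on :: "('a \<Rightarrow> real) \<Rightarrow> 'a set \<Rightarrow> 'a set" where
  "argmin_on f A = {z \<in> A. \<forall>y\<in>A. f z \<le> f y}"

abbreviation argmin :: "('a \<Rightarrow> real) \<Rightarrow> 'a set" where
  "argmin f \<equiv> argmin_on f UNIV"

definition fenchel_conjugate :: "('a::real_inner \<Rightarrow> real) \<Rightarrow> 'a \<Rightarrow> ereal" where
  "fenchel_conjugate f p = (SUP x. ereal (inner p x - f x))"

definition support_function :: "'a::real_inner set \<Rightarrow> 'a \<Rightarrow> ereal" where
  "support_function C p = (SUP x\<in>C. ereal (inner p x))"

definition normal_cone :: "'a::real_inner set \<Rightarrow> 'a \<Rightarrow> 'a set" where
  "normal_cone C x = (if x \<in> C then {p. \<forall>y\<in>C. inner p (y - x) \<le> 0} else {})"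

definition normal_cone_range :: "'a::real_inner set \<Rightarrow> 'a set" where
  "normal_cone_range C = (\<Union>x. normal_cone C x)"

section \<open>Functions on the half-line\<close>

text \<open>
  Functions on \<open>[0, \<infinity>)\<close> are modelled by functions on \<^typ>\<open>real\<close> whose values at negative
  arguments are irrelevant; in particular the derivative at \<open>0\<close> is the right derivative.
\<close>

definition tderiv :: "(real \<Rightarrow> 'a::real_normed_vector) \<Rightarrow> real \<Rightarrow> 'a" where
  "tderiv f t = vector_derivative f (at t within {0..})"

definition C1_halfline :: "(real \<Rightarrow> 'a::real_normed_vector) \<Rightarrow> bool" where
  "C1_halfline f \<longleftrightarrow> f differentiable_on {0..} \<and> continuous_on {0..} (tderiv f)"

definition abs_continuous_on_interval ::
    "real \<Rightarrow> real \<Rightarrow> (real \<Rightarrow> 'a::real_normed_vector) \<Rightarrow> bool" where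
  "abs_continuous_on_interval a b f \<longleftrightarrow>
     (\<forall>\<epsilon>>0. \<exists>\<delta>>0. \<forall>(n::nat) l r.
        (\<forall>i<n. a \<le> l i \<and> l i \<le> r i \<and> r i \<le> b) \<longrightarrow>
        disjoint_family_on (\<lambda>i. {l i<..<r i}) {..<n} \<longrightarrow>
        (\<Sum>i<n. r i - l i) < \<delta> \<longrightarrow>
        (\<Sum>i<n. norm (f (r i) - f (l i))) < \<epsilon>)"

definition locally_abs_continuous :: "(real \<Rightarrow> 'a::real_normed_vector) \<Rightarrow> bool" where
  "locally_abs_continuous f \<longleftrightarrow> (\<forall>b>0. abs_continuous_on_interval 0 b f)"

text \<open>
  Since \<open>x'\<close> is required to be a locally absolutely continuous function with a prescribed value
  at \<open>0\<close>, it exists at every \<open>t \<ge> 0\<close>; the second derivative exists only almost everywhere.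
\<close>

definition strong_global_solution ::
    "real \<Rightarrow> real \<Rightarrow> (real \<Rightarrow> real) \<Rightarrow> ('a::real_inner \<Rightarrow> real) \<Rightarrow> ('a \<Rightarrow> real) \<Rightarrow>
      'a \<Rightarrow> 'a \<Rightarrow> (real \<Rightarrow> 'a) \<Rightarrow> bool" where
  "strong_global_solution \<gamma> lam \<beta> \<Phi> \<Psi> u\<^sub>0 v\<^sub>0 x \<longleftrightarrow>
     x differentiable_on {0..} \<and>
     locally_abs_continuous x \<and> locally_abs_continuous (tderiv x) \<and>
     x 0 = u\<^sub>0 \<and> tderiv x 0 = v\<^sub>0 \<and>
     (AE t\<in>{0..} in lebesgue.
        tderiv x differentiable (at t within {0..}) \<and>
        tderiv (tderiv x) t + \<gamma> *\<^sub>R tderiv x t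
          + lam *\<^sub>R blinfun_apply (hessian \<Phi> (x t)) (tderiv x t)
          + (lam * \<beta> t) *\<^sub>R blinfun_apply (hessian \<Psi> (x t)) (tderiv x t)
          + grad \<Phi> (x t)
          + (\<beta> t + lam * tderiv \<beta> t) *\<^sub>R grad \<Psi> (x t) = 0)"

end

theory Submission
  imports Defs
begin

text \<open>
  The equation expresses the almost everywhere derivative of \<open>x'\<close> by a continuous function of
  time, so by absolute continuity it holds at every \<open>t \<ge> 0\<close>.

  Write \<open>G = \<nabla>\<Phi>(x) + \<beta> \<nabla>\<Psi>(x)\<close> and, for \<open>z \<in> S\<close>, \<open>w = x' + \<gamma> (x - z) + \<lambda> G\<close>.  It then
  says exactly that \<open>w' = - G\<close>.  For the energy \<open>E = |w|\<^sup>2 / 2 + \<Phi>(x) + \<beta> \<Psi>(x)\<close> one computes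
  \<open>E' = - \<gamma> \<langle>G, x - z\<rangle> - \<lambda> |G|\<^sup>2 + \<beta>' \<Psi>(x)\<close>.  Strong convexity bounds \<open>\<langle>G, x - z\<rangle>\<close> from below
  by \<open>\<langle>\<nabla>\<Phi>(z), x - z\<rangle> + \<beta> \<Psi>(x) + \<mu>/2 |x - z|\<^sup>2\<close>; since \<open>\<beta>' \<le> k \<beta>\<close> and \<open>k < \<gamma>\<close>, this gives
  \<open>E' \<le> (\<gamma> - k) (\<langle>q, x - z\<rangle> - \<beta> \<Psi>(x)) - \<gamma> \<mu>/2 |x - z|\<^sup>2\<close> with \<open>q = - \<gamma>/(\<gamma> - k) \<nabla>\<Phi>(z)\<close>, a
  normal vector to \<open>argmin \<Psi>\<close> at \<open>z\<close>.  The bracket is at most the integrand of hypothesis (4)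
  for \<open>p = q\<close>.  Hence \<open>w\<close> is bounded and \<open>|x - z|\<^sup>2\<close> is integrable.  As the derivative of
  \<open>|x - z|\<^sup>2\<close> is bounded above, \<open>|x - z|\<close> tends to \<open>0\<close>; uniqueness of \<open>z\<close> is then uniqueness of
  limits.
\<close>

section \<open>Absolutely continuous functions\<close>

text \<open>The definition indexes intervals by initial segments of the naturals. A bijection with
  \<open>{..<card I}\<close> transfers it to any finite index set, so that the tagged pieces of a
  division can later serve as their own indices.\<close>

lemma abs_continuous_on_intervalD:
  assumes "abs_continuous_on_interval a b f" "\<epsilon> > 0"
  obtains \<delta> where "\<delta> > 0"
    "\<And>I (l :: 'i \<Rightarrow> real) r. \<lbrakk>finite I; \<And>i. i \<in> I \<Longrightarrow> a \<le> l i \<and> l i \<le> r i \<and> r i \<le> b;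
        disjoint_family_on (\<lambda>i. {l i<..<r i}) I; (\<Sum>i\<in>I. r i - l i) < \<delta>\<rbrakk>
      \<Longrightarrow> (\<Sum>i\<in>I. norm (f (r i) - f (l i))) < \<epsilon>"
proof -
  obtain \<delta> where "\<delta> > 0" and \<delta>: "\<forall>(n::nat) l r. (\<forall>i<n. a \<le> l i \<and> l i \<le> r i \<and> r i \<le> b) \<longrightarrow>
        disjoint_family_on (\<lambda>i. {l i<..<r i}) {..<n} \<longrightarrow> (\<Sum>i<n. r i - l i) < \<delta> \<longrightarrow>
        (\<Sum>i<n. norm (f (r i) - f (l i))) < \<epsilon>"
    using assms(1)[unfolded abs_continuous_on_interval_def, rule_format, OF assms(2)] by (elim exE conjE)
  have "(\<Sum>i\<in>I. norm (f (r i) - f (l i))) < \<epsilon>"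
    if "finite I" "\<And>i. i \<in> I \<Longrightarrow> a \<le> l i \<and> l i \<le> r i \<and> r i \<le> b"
      "disjoint_family_on (\<lambda>i. {l i<..<r i}) I" "(\<Sum>i\<in>I. r i - l i) < \<delta>"
    for I and l r :: "'i \<Rightarrow> real"
  proof -
    obtain h where h: "bij_betw h {..<card I} I"
      using ex_bij_betw_nat_finite[OF \<open>finite I\<close>] by (auto simp: atLeast0LessThan)
    have "inj_on h {..<card I}" and hI: "\<And>i. i < card I \<Longrightarrow> h i \<in> I"
      using h by (auto simp: bij_betw_def)
    have "disjoint_family_on (\<lambda>i. {l (h i)<..<r (h i)}) {..<card I}"
      using that(3) hI \<open>inj_on h _\<close> unfolding disjoint_family_on_def
      by (metis inj_on_contraD lessThan_iff)
    moreover have "(\<Sum>i<card I. r (h i) - l (h i)) < \<delta>"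
      using sum.reindex_bij_betw[OF h, of "\<lambda>i. r i - l i"] that(4) by simp
    ultimately have "(\<Sum>i<card I. norm (f (r (h i)) - f (l (h i)))) < \<epsilon>"
      using \<delta>[rule_format, of "card I" "l \<circ> h" "r \<circ> h"] that(2) hI by simp
    then show ?thesis
      using sum.reindex_bij_betw[OF h, of "\<lambda>i. norm (f (r i) - f (l i))"] by simp
  qed
  with \<open>\<delta> > 0\<close> show thesis using that by blast
qed

text \<open>Absolute continuity is applied to a family consisting of one interval, whose endpoints
  are the two points in whichever order they lie.\<close>

lemma abs_continuous_on_interval_imp_continuous_on:
  assumes "abs_continuous_on_interval a b f"
  shows "continuous_on {a..b} f"
  unfolding continuous_on_iff
proof (intro ballI allI impI)
  fix s \<epsilon> :: real
  assume s: "s \<in> {a..b}" and "\<epsilon> > 0"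
  obtain \<delta> where "\<delta> > 0" and
    \<delta>: "\<And>I (l :: unit \<Rightarrow> real) r. \<lbrakk>finite I; \<And>i. i \<in> I \<Longrightarrow> a \<le> l i \<and> l i \<le> r i \<and> r i \<le> b;
        disjoint_family_on (\<lambda>i. {l i<..<r i}) I; (\<Sum>i\<in>I. r i - l i) < \<delta>\<rbrakk>
      \<Longrightarrow> (\<Sum>i\<in>I. norm (f (r i) - f (l i))) < \<epsilon>"
    using abs_continuous_on_intervalD[OF assms \<open>\<epsilon> > 0\<close>] by blast
  have close: "norm (f v - f u) < \<epsilon>" if "a \<le> u" "u \<le> v" "v \<le> b" "v - u < \<delta>" for u v
    using \<delta>[of UNIV "\<lambda>_. u" "\<lambda>_. v"] that by (simp add: disjoint_family_on_def UNIV_unit)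
  have "dist (f t) (f s) < \<epsilon>" if "t \<in> {a..b}" "dist t s < \<delta>" for t
    using close[of s t] close[of t s] s that
    by (cases "s \<le> t") (auto simp: dist_norm norm_minus_commute)
  then show "\<exists>\<delta>>0. \<forall>t\<in>{a..b}. dist t s < \<delta> \<longrightarrow> dist (f t) (f s) < \<epsilon>"
    using \<open>\<delta> > 0\<close> by blast
qed

text \<open>The total length is the Lebesgue measure of a disjoint union contained in
  \<open>U\<close>. This bounds the lengths of division pieces that a gauge forces into a small open
  set.\<close>

lemma sum_length_disjoint_intervals_le:
  fixes l r :: "'i \<Rightarrow> real"
  assumes "finite I" "\<And>i. i \<in> I \<Longrightarrow> l i \<le> r i" "disjoint_family_on (\<lambda>i. {l i<..<r i}) I"
    and "\<And>i. i \<in> I \<Longrightarrow> {l i<..<r i} \<subseteq> U" "U \<in> sets lebesgue"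
  shows "ennreal (\<Sum>i\<in>I. r i - l i) \<le> emeasure lebesgue U"
proof -
  have "ennreal (\<Sum>i\<in>I. r i - l i) = (\<Sum>i\<in>I. emeasure lebesgue {l i<..<r i})"
    using assms(2) by (subst sum_ennreal[symmetric]) (auto intro!: sum.cong)
  also have "\<dots> = emeasure lebesgue (\<Union>i\<in>I. {l i<..<r i})"
    using assms by (intro sum_emeasure) auto
  also have "\<dots> \<le> emeasure lebesgue U"
    using assms by (intro emeasure_mono) auto
  finally show ?thesis .
qed

text \<open>The tags outside the exceptional null set are handled as in the usual fundamental theorem;
  the intervals tagged in the null set have small total length by a suitable gauge, so absolute
  continuity makes their increments negligible.\<close>

theorem abs_continuous_has_integral:
  fixes f :: "real \<Rightarrow> 'a::real_normed_vector"
  assumes "a \<le> b" and ac: "abs_continuous_on_interval a b f" and "negligible N"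
    and deriv: "\<And>t. t \<in> {a..b} - N \<Longrightarrow> (f has_vector_derivative g t) (at t within {a..b})"
  shows "(g has_integral (f b - f a)) {a..b}"
proof (cases "a = b")
  case True
  then show ?thesis by (simp add: has_integral_refl)
next
  case False
  with \<open>a \<le> b\<close> have "a < b" by simp
  \<comment> \<open>With the value 0 on \<open>N\<close>, the error of a piece tagged in
    \<open>N\<close> is, up to sign, just the increment of \<open>f\<close>.\<close>
  define g' where "g' t = (if t \<in> N then 0 else g t)" for t
  have "(g' has_integral (f b - f a)) {a..b}"
    unfolding has_integral_factor_content_real
  proof (intro allI impI)
    fix e :: real assume "e > 0"
    \<comment> \<open>Half of the tolerance goes to the pieces tagged in \<open>N\<close>, half to
      the others.\<close>
    define e1 where "e1 = e / 2"
    have "e1 > 0" "e1 * (b - a) > 0" using \<open>e > 0\<close> \<open>a < b\<close> by (auto simp: e1_def)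
    obtain \<delta> where "\<delta> > 0" and
      \<delta>: "\<And>I (l :: real \<times> real set \<Rightarrow> real) r. \<lbrakk>finite I; \<And>i. i \<in> I \<Longrightarrow> a \<le> l i \<and> l i \<le> r i \<and> r i \<le> b;
        disjoint_family_on (\<lambda>i. {l i<..<r i}) I; (\<Sum>i\<in>I. r i - l i) < \<delta>\<rbrakk>
      \<Longrightarrow> (\<Sum>i\<in>I. norm (f (r i) - f (l i))) < e1 * (b - a)"
      using abs_continuous_on_intervalD[OF ac \<open>e1 * (b - a) > 0\<close>] by blast
    have N: "N \<in> null_sets lebesgue"
      using \<open>negligible N\<close> by (simp add: negligible_iff_null_sets)
    then obtain U where U: "open U" "N \<subseteq> U" "U - N \<in> lmeasurable" "emeasure lebesgue (U - N) < ennreal \<delta>"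
      using sets_lebesgue_outer_open[of N \<delta>] \<open>\<delta> > 0\<close> by blast
    have Usets: "U \<in> sets lebesgue" using \<open>open U\<close> by auto
    have Usmall: "emeasure lebesgue U < ennreal \<delta>"
      using U(4) emeasure_Diff_null_set[OF N Usets] by simp
    have "\<exists>d>0. t \<in> {a..b} - N \<longrightarrow>
        (\<forall>y\<in>{a..b}. norm (y - t) < d \<longrightarrow> norm (f y - f t - (y - t) *\<^sub>R g t) \<le> e1 * norm (y - t))" for t
      using deriv[unfolded has_vector_derivative_def has_derivative_within_alt] \<open>e1 > 0\<close>
      by (cases "t \<in> {a..b} - N") (blast, auto intro: zero_less_one)
    then obtain d where d0: "\<And>t. 0 < d t" and
      d: "\<And>t y. \<lbrakk>t \<in> {a..b} - N; y \<in> {a..b}; norm (y - t) < d t\<rbrakk>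
            \<Longrightarrow> norm (f y - f t - (y - t) *\<^sub>R g t) \<le> e1 * norm (y - t)"
      by metis
    \<comment> \<open>Pieces tagged in \<open>N\<close> must lie in \<open>U\<close>, whose measure
      is below the threshold \<open>\<delta>\<close> of absolute continuity; the others must lie
      where the linear approximation of \<open>f\<close> at the tag is good.\<close>
    define D where "D t = (if t \<in> N then U else ball t (d t))" for t
    have gauge: "gauge D"
      using U d0 by (auto simp: D_def gauge_def)
    have bound: "norm ((\<Sum>(t, K)\<in>p. measure lborel K *\<^sub>R g' t) - (f b - f a)) \<le> e * measure lborel {a..b}"
      if p: "p tagged_division_of {a..b}" and fine: "D fine p" for p
    proof -
      note pD = tagged_division_ofD[OF p]
      define l r where "l i = Inf (snd i)" and "r i = Sup (snd i)" for i :: "real \<times> real set"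
      have int: "snd i = {l i..r i} \<and> a \<le> l i \<and> l i \<le> r i \<and> r i \<le> b \<and> fst i \<in> {l i..r i} \<and> fst i \<in> {a..b}"
        if i: "i \<in> p" for i
      proof -
        obtain u v where K: "snd i = {u..v}"
          using pD(4)[of "fst i" "snd i"] i by auto
        have "fst i \<in> snd i" "snd i \<subseteq> {a..b}" using pD(2,3)[of "fst i" "snd i"] i by auto
        then show ?thesis using K by (auto simp: l_def r_def)
      qed
      define err where "err i = measure lborel (snd i) *\<^sub>R g' (fst i) - (f (r i) - f (l i))" for i
      have cont: "measure lborel (snd i) = r i - l i" if "i \<in> p" for i
        using int[OF that] by simp
      have total: "(\<Sum>i\<in>p. r i - l i) = b - a" "(\<Sum>i\<in>p. f (r i) - f (l i)) = f b - f a"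
        using additive_tagged_division_1[OF \<open>a \<le> b\<close> p, of "\<lambda>x. x"]
          additive_tagged_division_1[OF \<open>a \<le> b\<close> p, of f]
        by (auto simp: l_def r_def split_def)
      let ?pN = "{i \<in> p. fst i \<in> N}" and ?pR = "{i \<in> p. fst i \<notin> N}"
      have "finite p" by (fact pD(1))
      have "(\<Sum>i\<in>?pN. norm (err i)) \<le> e1 * (b - a)"
      proof -
        have disj: "disjoint_family_on (\<lambda>i. {l i<..<r i}) ?pN"
          unfolding disjoint_family_on_def
        proof (intro ballI impI)
          fix i j assume "i \<in> ?pN" "j \<in> ?pN" "i \<noteq> j"
          then have "interior (snd i) \<inter> interior (snd j) = {}"
            using pD(5)[of "fst i" "snd i" "fst j" "snd j"] by (auto simp: prod_eq_iff)
          moreover have "interior (snd i) = {l i<..<r i}" "interior (snd j) = {l j<..<r j}"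
            using int[of i] int[of j] \<open>i \<in> ?pN\<close> \<open>j \<in> ?pN\<close> by (metis (lifting) interior_atLeastAtMost_real mem_Collect_eq)+
          ultimately show "{l i<..<r i} \<inter> {l j<..<r j} = {}" by simp
        qed
        have "{l i<..<r i} \<subseteq> U" if "i \<in> ?pN" for i
        proof -
          have "snd i \<subseteq> U"
            using fine that unfolding fine_def D_def by (cases i) fastforce
          then show ?thesis using int[of i] that by auto
        qed
        then have "ennreal (\<Sum>i\<in>?pN. r i - l i) \<le> emeasure lebesgue U"
          using int \<open>finite p\<close> disj Usets by (intro sum_length_disjoint_intervals_le) auto
        with Usmall have "ennreal (\<Sum>i\<in>?pN. r i - l i) < ennreal \<delta>" by (rule le_less_trans[rotated])
        then have "(\<Sum>i\<in>?pN. r i - l i) < \<delta>"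
          using int by (subst (asm) ennreal_less_iff) (auto intro!: sum_nonneg)
        then have "(\<Sum>i\<in>?pN. norm (f (r i) - f (l i))) < e1 * (b - a)"
          using int \<open>finite p\<close> disj by (intro \<delta>) auto
        moreover have "norm (err i) = norm (f (r i) - f (l i))" if "i \<in> ?pN" for i
          using that by (auto simp: err_def g'_def norm_minus_commute)
        ultimately show ?thesis by simp
      qed
      moreover have "(\<Sum>i\<in>?pR. norm (err i)) \<le> e1 * (b - a)"
      proof -
        have "norm (err i) \<le> e1 * (r i - l i)" if i: "i \<in> ?pR" for i
        proof -
          let ?t = "fst i"
          have ip: "i \<in> p" using i by simp
          have "snd i \<subseteq> ball ?t (d ?t)"
            using fine i unfolding fine_def D_def by (cases i) fastforce
          have "l i \<in> snd i" "r i \<in> snd i" using int[of i] i by auto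
          with \<open>snd i \<subseteq> _\<close> have "l i \<in> ball ?t (d ?t)" "r i \<in> ball ?t (d ?t)" by blast+
          then have *: "norm (f (l i) - f ?t - (l i - ?t) *\<^sub>R g ?t) \<le> e1 * norm (l i - ?t)"
            "norm (f (r i) - f ?t - (r i - ?t) *\<^sub>R g ?t) \<le> e1 * norm (r i - ?t)"
            using d[of ?t "l i"] d[of ?t "r i"] int[of i] i by (auto simp: dist_real_def)
          \<comment> \<open>The tag splits the piece: the error is the difference of the
            linearisation errors at the two endpoints, both based at the tag. Since the tag lies
            between the endpoints, their distances to it add up to \<open>r i - l i\<close>.\<close>
          have err: "err i = (f (l i) - f ?t - (l i - ?t) *\<^sub>R g ?t) - (f (r i) - f ?t - (r i - ?t) *\<^sub>R g ?t)"
            unfolding err_def cont[OF ip] using i by (simp add: g'_def algebra_simps)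
          have "norm (err i) \<le> e1 * norm (l i - ?t) + e1 * norm (r i - ?t)"
            unfolding err by (intro order_trans[OF norm_triangle_ineq4 add_mono] *)
          also have "\<dots> = e1 * (r i - l i)" using int[of i] i by (auto simp: algebra_simps)
          finally show ?thesis .
        qed
        then have "(\<Sum>i\<in>?pR. norm (err i)) \<le> (\<Sum>i\<in>?pR. e1 * (r i - l i))" by (rule sum_mono)
        also have "\<dots> \<le> (\<Sum>i\<in>p. e1 * (r i - l i))"
          using int \<open>finite p\<close> \<open>e1 > 0\<close> by (intro sum_mono2) auto
        also have "\<dots> = e1 * (b - a)" by (simp add: sum_distrib_left[symmetric] total)
        finally show ?thesis .
      qed
      moreover have "(\<Sum>i\<in>p. norm (err i)) = (\<Sum>i\<in>?pN. norm (err i)) + (\<Sum>i\<in>?pR. norm (err i))"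
        using \<open>finite p\<close> by (subst sum.union_disjoint[symmetric]) (auto intro!: sum.cong)
      ultimately have "(\<Sum>i\<in>p. norm (err i)) \<le> e * (b - a)"
        by (simp add: e1_def field_simps)
      moreover have "(\<Sum>(t, K)\<in>p. measure lborel K *\<^sub>R g' t) - (f b - f a) = (\<Sum>i\<in>p. err i)"
        by (simp add: err_def sum_subtractf split_def total(2)[symmetric])
      ultimately show ?thesis
        using norm_sum[of err p] \<open>a \<le> b\<close> by (simp add: content_real)
    qed
    show "\<exists>D. gauge D \<and> (\<forall>p. p tagged_division_of {a..b} \<and> D fine p \<longrightarrow>
      norm ((\<Sum>(t, K)\<in>p. measure lborel K *\<^sub>R g' t) - (f b - f a)) \<le> e * measure lborel {a..b})"
      using gauge bound by (intro exI[of _ D]) simp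
  qed
  then show ?thesis
    using \<open>negligible N\<close> by (rule has_integral_spike[rotated 2]) (simp add: g'_def)
qed

section \<open>Recovering derivatives everywhere from integrals of a continuous function\<close>

lemma abs_continuous_on_interval_subinterval:
  assumes "abs_continuous_on_interval a b f" "a \<le> c" "d \<le> b"
  shows "abs_continuous_on_interval c d f"
  using assms unfolding abs_continuous_on_interval_def by (meson order_trans)

text \<open>The linearisation error over an interval is the integral of \<open>g - g s\<close>,
  which is small near \<open>s\<close> by continuity. At \<open>s = a\<close> the derivative is
  one-sided.\<close>

lemma has_integral_imp_has_vector_derivative:
  fixes f :: "real \<Rightarrow> 'a::real_normed_vector"
  assumes int: "\<And>s t. \<lbrakk>a \<le> s; s \<le> t\<rbrakk> \<Longrightarrow> (g has_integral (f t - f s)) {s..t}"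
    and cont: "continuous_on {a..} g" and "a \<le> s"
  shows "(f has_vector_derivative g s) (at s within {a..})"
  unfolding has_vector_derivative_def has_derivative_within_alt
proof (intro conjI allI impI)
  show "bounded_linear (\<lambda>h. h *\<^sub>R g s)" by (rule bounded_linear_scaleR_left)
  fix e :: real assume "e > 0"
  then obtain d where "d > 0" and d: "\<And>t. \<lbrakk>a \<le> t; dist t s < d\<rbrakk> \<Longrightarrow> dist (g t) (g s) < e"
    using cont \<open>a \<le> s\<close> unfolding continuous_on_iff by (metis atLeast_iff)
  \<comment> \<open>Stated for an ordered pair \<open>u \<le> v\<close>, so that it serves for
    increments on either side of \<open>s\<close>.\<close>
  have *: "norm (f v - f u - (v - u) *\<^sub>R g s) \<le> e * (v - u)"
    if "a \<le> u" "u \<le> v" "\<And>\<tau>. \<tau> \<in> {u..v} \<Longrightarrow> dist \<tau> s < d" for u v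
  proof -
    have "((\<lambda>\<tau>. g \<tau> - g s) has_integral (f v - f u - measure lborel {u..v} *\<^sub>R g s)) {u..v}"
      using int that by (intro has_integral_diff has_integral_const_real) auto
    moreover have "norm (g \<tau> - g s) \<le> e" if "\<tau> \<in> {u..v}" for \<tau>
      using d[of \<tau>] that \<open>a \<le> u\<close> \<open>\<And>\<tau>. \<tau> \<in> {u..v} \<Longrightarrow> dist \<tau> s < d\<close>
      by (force simp: dist_norm)
    ultimately show ?thesis
      using has_integral_bound[of e "\<lambda>\<tau>. g \<tau> - g s" _ u v] \<open>e > 0\<close> \<open>u \<le> v\<close> by (simp add: content_real)
  qed
  have "norm (f t - f s - (t - s) *\<^sub>R g s) \<le> e * norm (t - s)" if "t \<in> {a..}" "norm (t - s) < d" for t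
  proof (cases "s \<le> t")
    case True
    then show ?thesis using *[of s t] that \<open>a \<le> s\<close> by (auto simp: dist_real_def)
  next
    case False
    have "norm (f t - f s - (t - s) *\<^sub>R g s) = norm (f s - f t - (s - t) *\<^sub>R g s)"
      by (subst norm_minus_cancel[symmetric]) (simp add: algebra_simps)
    then show ?thesis using *[of t s] that False by (auto simp: dist_real_def)
  qed
  then show "\<exists>d>0. \<forall>t\<in>{a..}. norm (t - s) < d \<longrightarrow> norm (f t - f s - (t - s) *\<^sub>R g s) \<le> e * norm (t - s)"
    using \<open>d > 0\<close> by blast
qed

text \<open>The integral does not see the exceptional null set, so the increments of
  \<open>f\<close> are integrals of the continuous \<open>g\<close>; such integrals are
  differentiable at every point.\<close>

lemma abs_continuous_has_vector_derivative_everywhere: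
  fixes f :: "real \<Rightarrow> 'a::real_normed_vector"
  assumes ac: "locally_abs_continuous f" and cont: "continuous_on {0..} g"
    and ae: "AE t\<in>{0..} in lebesgue. (f has_vector_derivative g t) (at t within {0..})" and "t \<ge> 0"
  shows "(f has_vector_derivative g t) (at t within {0..})"
proof -
  obtain N where "N \<in> null_sets lebesgue"
    and N: "{t. \<not> (t \<in> {0..} \<longrightarrow> (f has_vector_derivative g t) (at t within {0..}))} \<subseteq> N"
    using ae unfolding eventually_ae_filter by auto
  then have "negligible N" by (simp add: negligible_iff_null_sets)
  have "(g has_integral (f v - f u)) {u..v}" if "0 \<le> u" "u \<le> v" for u v
  proof (rule abs_continuous_has_integral[OF \<open>u \<le> v\<close> _ \<open>negligible N\<close>])
    \<comment> \<open>The right end is \<open>v + 1\<close> because local absolute continuity speaks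
      of positive ends only, while \<open>v\<close> may be 0.\<close>
    have "abs_continuous_on_interval 0 (v + 1) f"
      using ac that by (auto simp: locally_abs_continuous_def)
    then show "abs_continuous_on_interval u v f"
      using that by (rule_tac abs_continuous_on_interval_subinterval) auto
    fix t assume "t \<in> {u..v} - N"
    then have "t \<in> {0..}" "t \<notin> N" using that by auto
    then have "(f has_vector_derivative g t) (at t within {0..})" using N by blast
    then show "(f has_vector_derivative g t) (at t within {u..v})"
      using that by (rule_tac has_vector_derivative_within_subset) auto
  qed
  then show ?thesis using cont \<open>t \<ge> 0\<close> by (rule has_integral_imp_has_vector_derivative)
qed

section \<open>Gradient inequalities and normal cones\<close>

text \<open>The limit is taken from the right because the convexity inequalities along a segment
  hold for parameters in \<open>{0..1}\<close>.\<close>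

lemma GDERIV_directional:
  assumes "GDERIV f x :> g"
  shows "((\<lambda>t. (f (x + t *\<^sub>R u) - f x) / t) \<longlongrightarrow> inner g u) (at_right 0)"
proof -
  have "((\<lambda>t. x + t *\<^sub>R u) has_derivative (\<lambda>t. t *\<^sub>R u)) (at 0)"
    by (auto intro!: derivative_eq_intros)
  then have "((\<lambda>t. f (x + t *\<^sub>R u)) has_derivative (\<lambda>t. inner (t *\<^sub>R u) g)) (at 0)"
    by (rule has_derivative_compose) (use assms in \<open>simp add: gderiv_def\<close>)
  then have "((\<lambda>t. f (x + t *\<^sub>R u)) has_real_derivative inner g u) (at 0)"
    unfolding has_field_derivative_def
    by (rule has_derivative_eq_rhs) (simp add: fun_eq_iff inner_commute mult.commute)
  then show ?thesis
    unfolding DERIV_def by (auto intro: tendsto_within_subset)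
qed

text \<open>Divide the inequality on the segment from \<open>x\<close> to \<open>y\<close> by
  \<open>t\<close> and let \<open>t\<close> tend to 0 from the right. The modulus \<open>m\<close>
  is arbitrary, so \<open>m = 0\<close> gives the inequality for convex functions.\<close>

lemma strong_convexity_gradient_inequality:
  assumes f: "\<And>t. t \<in> {0..1} \<Longrightarrow>
      f ((1 - t) *\<^sub>R x + t *\<^sub>R y) \<le> (1 - t) * f x + t * f y - m / 2 * t * (1 - t) * (norm (x - y))\<^sup>2"
    and "GDERIV f x :> g"
  shows "f x + inner g (y - x) + m / 2 * (norm (x - y))\<^sup>2 \<le> f y"
proof -
  have lim: "((\<lambda>t. f y - f x - m / 2 * (1 - t) * (norm (x - y))\<^sup>2) \<longlongrightarrow>
      f y - f x - m / 2 * (1 - 0) * (norm (x - y))\<^sup>2) (at_right 0)"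
    by (intro tendsto_intros)
  have "(f (x + t *\<^sub>R (y - x)) - f x) / t \<le> f y - f x - m / 2 * (1 - t) * (norm (x - y))\<^sup>2"
    if "0 < t" "t < 1" for t
  proof -
    have "(1 - t) *\<^sub>R x + t *\<^sub>R y = x + t *\<^sub>R (y - x)" by (simp add: algebra_simps)
    then have "f (x + t *\<^sub>R (y - x)) - f x \<le> t * (f y - f x - m / 2 * (1 - t) * (norm (x - y))\<^sup>2)"
      using f[of t] that by (simp add: algebra_simps)
    then show ?thesis using that by (simp add: divide_le_eq mult.commute)
  qed
  then have "\<forall>\<^sub>F t in at_right 0. (f (x + t *\<^sub>R (y - x)) - f x) / t
      \<le> f y - f x - m / 2 * (1 - t) * (norm (x - y))\<^sup>2"
    unfolding eventually_at_right_field by (intro exI[of _ 1]) auto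
  from tendsto_le[OF _ lim GDERIV_directional[OF assms(2)] this] show ?thesis
    by simp
qed

lemma convex_gradient_inequality:
  assumes "convex_on UNIV f" "GDERIV f x :> g"
  shows "f x + inner g (y - x) \<le> f y"
  using strong_convexity_gradient_inequality[of f x y 0 g] assms by (auto simp: convex_on_def)

text \<open>First-order optimality: difference quotients at \<open>z\<close> along segments inside
  \<open>C\<close> are nonnegative, and so is their limit. The factor \<open>c\<close> allows for
  the rescaled gradient in the energy estimate.\<close>

lemma minimizer_on_convex_imp_normal_cone:
  assumes "convex C" "z \<in> C" "\<And>y. y \<in> C \<Longrightarrow> f z \<le> f y" "GDERIV f z :> g" "c \<ge> 0"
  shows "- (c *\<^sub>R g) \<in> normal_cone C z"
proof -
  have "0 \<le> inner g (y - z)" if "y \<in> C" for y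
  proof -
    have "0 \<le> (f (z + t *\<^sub>R (y - z)) - f z) / t" if t: "0 < t" "t < 1" for t
    proof -
      have "z + t *\<^sub>R (y - z) = (1 - t) *\<^sub>R z + t *\<^sub>R y" by (simp add: algebra_simps)
      also have "\<dots> \<in> C" using assms(1,2) \<open>y \<in> C\<close> t by (simp add: convex_alt)
      finally show ?thesis using assms(3) t by simp
    qed
    then have "\<forall>\<^sub>F t in at_right 0. 0 \<le> (f (z + t *\<^sub>R (y - z)) - f z) / t"
      unfolding eventually_at_right_field by (intro exI[of _ 1]) auto
    then show ?thesis
      by (intro tendsto_lowerbound[OF GDERIV_directional[OF assms(4)]]) auto
  qed
  then show ?thesis using assms(2,5) by (simp add: normal_cone_def)
qed

lemma strongly_convexE:
  assumes "strongly_convex f"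
  obtains \<mu> where "\<mu> > 0"
    "\<And>x y g. GDERIV f x :> g \<Longrightarrow> f x + inner g (y - x) + \<mu> / 2 * (norm (x - y))\<^sup>2 \<le> f y"
proof -
  obtain \<mu> where "\<mu> > 0" and \<mu>: "\<forall>x y. \<forall>t\<in>{0..1}. f ((1 - t) *\<^sub>R x + t *\<^sub>R y)
      \<le> (1 - t) * f x + t * f y - \<mu> / 2 * t * (1 - t) * (norm (x - y))\<^sup>2"
    using assms unfolding strongly_convex_def by (elim exE conjE)
  have "f x + inner g (y - x) + \<mu> / 2 * (norm (x - y))\<^sup>2 \<le> f y" if "GDERIV f x :> g" for x y g
    using \<mu> that by (intro strong_convexity_gradient_inequality) auto
  with \<open>\<mu> > 0\<close> show thesis using that by blast
qed

text \<open>The conjugate is bounded below by its term at \<open>y\<close>, and normality at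
  \<open>z\<close> bounds the support function above by the value at \<open>z\<close>; subtracting
  and multiplying by \<open>b\<close> removes the scaling of \<open>q\<close>. The extended
  nonnegative values match the integrand of hypothesis (4).\<close>

lemma normal_cone_excess_ge:
  assumes q: "q \<in> normal_cone C z" and "b > 0"
  shows "ennreal (max 0 (inner q (y - z) - b * \<Psi> y))
    \<le> e2ennreal (ereal b * (fenchel_conjugate \<Psi> (q /\<^sub>R b) - support_function C (q /\<^sub>R b)))"
proof -
  have "support_function C (q /\<^sub>R b) \<le> ereal (inner (q /\<^sub>R b) z)"
    using q \<open>b > 0\<close> unfolding support_function_def normal_cone_def
    by (intro SUP_least) (auto simp: inner_diff_right split: if_splits intro!: mult_left_mono)
  moreover have "ereal (inner (q /\<^sub>R b) y - \<Psi> y) \<le> fenchel_conjugate \<Psi> (q /\<^sub>R b)"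
    unfolding fenchel_conjugate_def by (rule SUP_upper) simp
  ultimately have "ereal (inner (q /\<^sub>R b) y - \<Psi> y) - ereal (inner (q /\<^sub>R b) z)
      \<le> fenchel_conjugate \<Psi> (q /\<^sub>R b) - support_function C (q /\<^sub>R b)"
    by (intro ereal_minus_mono)
  then have "ereal b * (ereal (inner (q /\<^sub>R b) y - \<Psi> y) - ereal (inner (q /\<^sub>R b) z))
      \<le> ereal b * (fenchel_conjugate \<Psi> (q /\<^sub>R b) - support_function C (q /\<^sub>R b))"
    using \<open>b > 0\<close> by (intro ereal_mult_left_mono) auto
  moreover have "b * (inner (q /\<^sub>R b) y - \<Psi> y - inner (q /\<^sub>R b) z) = inner q (y - z) - b * \<Psi> y"
    using \<open>b > 0\<close> by (simp add: inner_diff_right field_simps)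
  ultimately have "ereal (inner q (y - z) - b * \<Psi> y)
      \<le> ereal b * (fenchel_conjugate \<Psi> (q /\<^sub>R b) - support_function C (q /\<^sub>R b))"
    by simp
  then have "e2ennreal (ereal (inner q (y - z) - b * \<Psi> y))
      \<le> e2ennreal (ereal b * (fenchel_conjugate \<Psi> (q /\<^sub>R b) - support_function C (q /\<^sub>R b)))"
    by (rule e2ennreal_mono)
  \<comment> \<open>\<open>e2ennreal\<close> sends negative numbers to 0, which is where the
    positive part comes from.\<close>
  moreover have "e2ennreal (ereal (inner q (y - z) - b * \<Psi> y)) = ennreal (max 0 (inner q (y - z) - b * \<Psi> y))"
    by (simp add: e2ennreal_ereal max_def ennreal_neg)
  ultimately show ?thesis by simp
qed

section \<open>Functions with bounded integrals\<close>

text \<open>Translates hypothesis (4), a Lebesgue integral over the half-line, into a uniform bound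
  for gauge integrals over \<open>{0..t}\<close>: on each such interval the two integrals
  agree.\<close>

lemma bounded_nn_integral_imp_bounded_integrals:
  fixes f :: "real \<Rightarrow> real"
  assumes "continuous_on {0..} f" "\<And>t. t \<ge> 0 \<Longrightarrow> 0 \<le> f t"
    and fin: "(\<integral>\<^sup>+t\<in>{0..}. ennreal (f t) \<partial>lebesgue) < \<infinity>"
  obtains R where "\<And>t. t \<ge> 0 \<Longrightarrow> integral {0..t} f \<le> R"
proof -
  obtain R where R: "0 \<le> R" "(\<integral>\<^sup>+t\<in>{0..}. ennreal (f t) \<partial>lebesgue) = ennreal R"
    using fin by (cases "\<integral>\<^sup>+t\<in>{0..}. ennreal (f t) \<partial>lebesgue") auto
  have "integral {0..t} f \<le> R" if "t \<ge> 0" for t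
  proof -
    have "f integrable_on {0..t}"
      using continuous_on_subset[OF assms(1)] by (intro integrable_continuous_real) auto
    then have "ennreal (integral {0..t} f) = (\<integral>\<^sup>+s\<in>{0..t}. ennreal (f s) \<partial>lebesgue)"
      using nn_integral_has_integral_lebesgue'[of "{0..t}" f "integral {0..t} f"] assms(2)
      by (simp add: nn_integral_completion integrable_integral)
    also have "\<dots> \<le> (\<integral>\<^sup>+s\<in>{0..}. ennreal (f s) \<partial>lebesgue)"
      by (intro nn_integral_mono) (auto simp: indicator_def)
    finally show ?thesis using R by (simp add: ennreal_le_iff)
  qed
  then show thesis using that by blast
qed

text \<open>If \<open>f t\<close> is at least \<open>\<epsilon>\<close>, the upper bound on the
  derivative keeps \<open>f\<close> above \<open>\<epsilon> / 2\<close> on a window of fixed length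
  before \<open>t\<close>. The bounded increasing primitive \<open>H\<close> cannot gain that fixed
  amount at late times. Looking backwards is why an upper bound suffices.\<close>

lemma integrable_nonneg_derivative_bounded_above_tendsto_0:
  fixes f :: "real \<Rightarrow> real"
  assumes nonneg: "\<And>t. t \<ge> 0 \<Longrightarrow> 0 \<le> f t"
    and deriv: "\<And>t. t \<ge> 0 \<Longrightarrow> (f has_vector_derivative f' t) (at t within {0..})"
    and upper: "\<And>t. t \<ge> 0 \<Longrightarrow> f' t \<le> C"
    and bound: "\<And>t. t \<ge> 0 \<Longrightarrow> integral {0..t} f \<le> M"
  shows "(f \<longlongrightarrow> 0) at_top"
proof -
  define K where "K = max C 1"
  have "K > 0" by (simp add: K_def)
  have growth: "f t - f s \<le> K * (t - s)" if "0 \<le> s" "s \<le> t" for s t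
  proof -
    have "(f' has_integral (f t - f s)) {s..t}"
      using that by (intro fundamental_theorem_of_calculus)
        (auto intro!: has_vector_derivative_within_subset[OF deriv])
    moreover have "((\<lambda>_. K) has_integral (K * (t - s))) {s..t}"
      using has_integral_const_real[of K s t] that by (simp add: mult.commute)
    ultimately show ?thesis
    proof (rule has_integral_le)
      fix r assume "r \<in> {s..t}"
      then show "f' r \<le> K" using upper[of r] that by (simp add: K_def)
    qed
  qed
  have cont: "continuous_on {0..} f"
    using deriv by (auto simp: continuous_on_eq_continuous_within intro: has_vector_derivative_continuous)
  have int: "f integrable_on {s..t}" if "0 \<le> s" for s t
    using continuous_on_subset[OF cont] that by (intro integrable_continuous_real) auto
  define H where "H t = integral {0..t} f" for t
  have split: "H t = H s + integral {s..t} f" if "0 \<le> s" "s \<le> t" for s t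
    using Henstock_Kurzweil_Integration.integral_combine[of 0 s t f] int[of 0 t] that by (simp add: H_def)
  have mono: "H s \<le> H t" if "0 \<le> s" "s \<le> t" for s t
    using split[OF that] integral_nonneg[OF int[of s t]] nonneg that by auto
  define L where "L = Sup (H ` {0..})"
  have bdd: "bdd_above (H ` {0..})" using bound by (auto simp: H_def intro!: bdd_aboveI2)
  have L: "H t \<le> L" if "t \<ge> 0" for t
    unfolding L_def using bdd that by (intro cSup_upper) auto
  have "\<forall>\<^sub>F t in at_top. \<bar>f t\<bar> < \<epsilon>" if "\<epsilon> > 0" for \<epsilon>
  proof -
    \<comment> \<open>In time \<open>\<delta>\<close> the function can rise by at most
      \<open>K * \<delta> = \<epsilon> / 2\<close>.\<close>
    define \<delta> where "\<delta> = \<epsilon> / (2 * K)"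
    have "\<delta> > 0" using \<open>\<epsilon> > 0\<close> \<open>K > 0\<close> by (simp add: \<delta>_def)
    \<comment> \<open>From \<open>T\<close> on, \<open>H\<close> can gain less than
      \<open>\<delta> * (\<epsilon> / 2)\<close>, the least mass of a bad window. For
      \<open>t \<ge> T + \<delta>\<close> the window before \<open>t\<close> starts no earlier than
      \<open>T\<close>.\<close>
    then have "L - \<delta> * (\<epsilon> / 2) < L" using \<open>\<epsilon> > 0\<close> by simp
    then obtain T where T: "T \<ge> 0" "L - \<delta> * (\<epsilon> / 2) < H T"
      unfolding L_def by (subst (asm) less_cSup_iff) (use bdd in auto)
    have "f t < \<epsilon>" if "t \<ge> T + \<delta>" for t
    proof (rule ccontr)
      assume "\<not> f t < \<epsilon>"
      have "\<epsilon> / 2 \<le> f s" if "s \<in> {t - \<delta>..t}" for s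
      proof -
        have "f t - f s \<le> K * (t - s)" using growth[of s t] that T \<open>t \<ge> T + \<delta>\<close> by auto
        also have "\<dots> \<le> K * \<delta>" using that \<open>K > 0\<close> by (intro mult_left_mono) auto
        also have "\<dots> = \<epsilon> / 2" using \<open>K > 0\<close> by (simp add: \<delta>_def)
        finally show ?thesis using \<open>\<not> f t < \<epsilon>\<close> by linarith
      qed
      moreover have "((\<lambda>_. \<epsilon> / 2) has_integral (\<delta> * (\<epsilon> / 2))) {t - \<delta>..t}"
        using has_integral_const_real[of "\<epsilon> / 2" "t - \<delta>" t] \<open>\<delta> > 0\<close> by simp
      moreover have "(f has_integral integral {t - \<delta>..t} f) {t - \<delta>..t}"
        using int[of "t - \<delta>" t] T \<open>t \<ge> T + \<delta>\<close> by (simp add: integrable_integral)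
      ultimately have "\<delta> * (\<epsilon> / 2) \<le> integral {t - \<delta>..t} f"
        by (blast intro: has_integral_le)
      moreover have "H t = H (t - \<delta>) + integral {t - \<delta>..t} f" "H T \<le> H (t - \<delta>)" "H t \<le> L"
        using split[of "t - \<delta>" t] mono[of T "t - \<delta>"] L[of t] T \<open>\<delta> > 0\<close> \<open>t \<ge> T + \<delta>\<close> by auto
      ultimately show False using T by linarith
    qed
    moreover have "\<bar>f t\<bar> = f t" if "t \<ge> T + \<delta>" for t
      using nonneg[of t] that T \<open>\<delta> > 0\<close> by auto
    ultimately show ?thesis
      unfolding eventually_at_top_linorder by (intro exI[of _ "T + \<delta>"]) auto
  qed
  then show ?thesis by (simp add: tendsto_iff dist_real_def)
qed

section \<open>Trajectories\<close>

lemma has_vector_derivative_GDERIV_compose: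
  assumes "(x has_vector_derivative v) (at t within S)" "GDERIV f (x t) :> g"
  shows "((\<lambda>s. f (x s)) has_vector_derivative inner g v) (at t within S)"
  using has_derivative_compose[of x "\<lambda>h. h *\<^sub>R v" t S f "\<lambda>h. inner h g"] assms
  by (simp add: has_vector_derivative_def gderiv_def inner_commute)

lemma has_vector_derivative_grad_compose:
  assumes "(x has_vector_derivative v) (at t within S)" "grad f differentiable (at (x t))"
  shows "((\<lambda>s. grad f (x s)) has_vector_derivative blinfun_apply (hessian f (x t)) v) (at t within S)"
  using has_derivative_compose[of x "\<lambda>h. h *\<^sub>R v" t S "grad f" "hessian f (x t)"] has_derivative_hessian[OF assms(2)] assms(1)
  by (simp add: has_vector_derivative_def blinfun.scaleR_right)

text \<open>The Hessian terms of the equation are absorbed into the derivative of \<open>w\<close>,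
  so the dynamics enter as \<open>x' = v\<close> and \<open>w' = - G\<close>, and hypothesis (4)
  enters as the bound \<open>R\<close>. An energy estimate bounds \<open>w\<close> and the integral
  of the squared distance to \<open>z\<close>.\<close>

lemma first_order_system_convergence:
  fixes \<Phi> \<Psi> :: "'a::{real_inner, complete_space} \<Rightarrow> real"
    and \<beta> \<beta>' :: "real \<Rightarrow> real" and x v w :: "real \<Rightarrow> 'a"
  defines "G \<equiv> \<lambda>t. grad \<Phi> (x t) + \<beta> t *\<^sub>R grad \<Psi> (x t)"
  assumes "lam > 0" "0 \<le> k" "k < \<gamma>" "\<mu> > 0"
    and \<Phi>: "\<And>y. GDERIV \<Phi> y :> grad \<Phi> y" and \<Psi>: "\<And>y. GDERIV \<Psi> y :> grad \<Psi> y"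
    and \<Phi>_ge: "\<And>y. m \<le> \<Phi> y" and \<Psi>_ge: "\<And>y. 0 \<le> \<Psi> y" and "\<Psi> z = 0"
    and \<Phi>_conv: "\<And>y u. \<Phi> y + inner (grad \<Phi> y) (u - y) + \<mu> / 2 * (norm (y - u))\<^sup>2 \<le> \<Phi> u"
    and \<Psi>_conv: "\<And>y u. \<Psi> y + inner (grad \<Psi> y) (u - y) \<le> \<Psi> u"
    and \<beta>_pos: "\<And>t. t \<ge> 0 \<Longrightarrow> 0 < \<beta> t"
    and \<beta>': "\<And>t. t \<ge> 0 \<Longrightarrow> (\<beta> has_vector_derivative \<beta>' t) (at t within {0..})"
    and \<beta>'_le: "\<And>t. t \<ge> 0 \<Longrightarrow> \<beta>' t \<le> k * \<beta> t"
    and x': "\<And>t. t \<ge> 0 \<Longrightarrow> (x has_vector_derivative v t) (at t within {0..})"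
    and w': "\<And>t. t \<ge> 0 \<Longrightarrow> (w has_vector_derivative - G t) (at t within {0..})"
    and w: "\<And>t. w t = v t + \<gamma> *\<^sub>R (x t - z) + lam *\<^sub>R G t"
    and q: "q = - ((\<gamma> / (\<gamma> - k)) *\<^sub>R grad \<Phi> z)"
    and R: "\<And>t. t \<ge> 0 \<Longrightarrow> integral {0..t} (\<lambda>s. max 0 (inner q (x s - z) - \<beta> s * \<Psi> (x s))) \<le> R"
  shows "(x \<longlongrightarrow> z) at_top"
proof -
  define f where "f t = (norm (x t - z))\<^sup>2" for t
  define r where "r t = max 0 (inner q (x t - z) - \<beta> t * \<Psi> (x t))" for t
  define E where "E t = inner (w t) (w t) / 2 + \<Phi> (x t) + \<beta> t * \<Psi> (x t)" for t
  define E' where "E' t = \<beta>' t * \<Psi> (x t) - \<gamma> * inner (G t) (x t - z) - lam * (norm (G t))\<^sup>2" for t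
  have f': "(f has_vector_derivative 2 * inner (x t - z) (v t)) (at t within {0..})" if "t \<ge> 0" for t
  proof -
    have h': "((\<lambda>t. x t - z) has_vector_derivative v t) (at t within {0..})"
      using has_vector_derivative_diff[OF x'[OF that] has_vector_derivative_const[of z]] by simp
    show ?thesis
      using bounded_bilinear.has_vector_derivative[OF bounded_bilinear_inner h' h']
      by (simp add: f_def[abs_def] power2_norm_eq_inner inner_commute)
  qed
  have E': "(E has_vector_derivative E' t) (at t within {0..})" if t: "t \<ge> 0" for t
  proof -
    have "(E has_vector_derivative
        (inner (w t) (- G t) + inner (- G t) (w t)) / 2 + inner (grad \<Phi> (x t)) (v t)
          + (\<beta> t * inner (grad \<Psi> (x t)) (v t) + \<beta>' t * \<Psi> (x t))) (at t within {0..})"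
      unfolding E_def
      by (intro has_vector_derivative_add has_vector_derivative_mult has_vector_derivative_divide
          bounded_bilinear.has_vector_derivative[OF bounded_bilinear_inner]
          has_vector_derivative_GDERIV_compose[OF x'[OF t]] \<Phi> \<Psi> w' \<beta>' t)
    moreover have "(inner (w t) (- G t) + inner (- G t) (w t)) / 2 + inner (grad \<Phi> (x t)) (v t)
          + (\<beta> t * inner (grad \<Psi> (x t)) (v t) + \<beta>' t * \<Psi> (x t)) = E' t"
    proof -
      \<comment> \<open>The potential terms contribute \<open>inner (G t) (v t)\<close> and the
        derivative of half the squared norm of \<open>w\<close> contributes its negative, so the
        velocity cancels.\<close>
      have "inner (grad \<Phi> (x t)) (v t) + \<beta> t * inner (grad \<Psi> (x t)) (v t) = inner (G t) (v t)"
        by (simp add: G_def inner_add_left)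
      moreover have half: "(inner (w t) (- G t) + inner (- G t) (w t)) / 2 = - inner (G t) (w t)"
        by (simp add: inner_commute)
      moreover have "inner (G t) (w t) = inner (G t) (v t) + \<gamma> * inner (G t) (x t - z) + lam * (norm (G t))\<^sup>2"
        by (simp add: w inner_add_right power2_norm_eq_inner)
      ultimately show ?thesis unfolding E'_def half by linarith
    qed
    ultimately show ?thesis by simp
  qed
  \<comment> \<open>The gap \<open>\<Phi> (x t) - \<Phi> z\<close> is kept, because it is used
    twice: linearised at \<open>z\<close> for the decay of the energy, and bounded below by
    \<open>m - \<Phi> z\<close> for the derivative of \<open>f\<close>.\<close>
  have G_ge: "\<Phi> (x t) - \<Phi> z + \<mu> / 2 * f t + \<beta> t * \<Psi> (x t) \<le> inner (G t) (x t - z)" if "t \<ge> 0" for t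
  proof -
    have "\<beta> t * \<Psi> (x t) \<le> \<beta> t * inner (grad \<Psi> (x t)) (x t - z)"
      using \<Psi>_conv[of "x t" z] \<beta>_pos[OF that] \<open>\<Psi> z = 0\<close>
      by (intro mult_left_mono) (auto simp: inner_diff_right)
    moreover have "\<Phi> (x t) - \<Phi> z + \<mu> / 2 * f t \<le> inner (grad \<Phi> (x t)) (x t - z)"
      using \<Phi>_conv[of "x t" z] by (simp add: f_def inner_diff_right)
    ultimately show ?thesis by (simp add: G_def inner_add_left)
  qed
  have E'_le: "E' t \<le> (\<gamma> - k) * r t - \<gamma> * \<mu> / 2 * f t" if "t \<ge> 0" for t
  proof -
    have "inner (grad \<Phi> z) (x t - z) \<le> \<Phi> (x t) - \<Phi> z"
    proof -
      have "0 \<le> \<mu> / 2 * (norm (z - x t))\<^sup>2" using \<open>\<mu> > 0\<close> by simp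
      then show ?thesis using \<Phi>_conv[of z "x t"] by linarith
    qed
    then have "\<gamma> * inner (grad \<Phi> z) (x t - z) \<le> \<gamma> * (\<Phi> (x t) - \<Phi> z)"
      using assms(3,4) by (intro mult_left_mono) auto
    \<comment> \<open>The share \<open>k\<close> of the coefficient \<open>\<gamma>\<close> of
      \<open>\<beta> t * \<Psi> (x t)\<close> pays for the growth of \<open>\<beta>\<close>. The
      scaling of \<open>q\<close> lets the remaining \<open>\<gamma> - k\<close> factor out of both
      terms of \<open>r\<close>.\<close>
    moreover have "\<gamma> * inner (grad \<Phi> z) (x t - z) = - ((\<gamma> - k) * inner q (x t - z))"
      using \<open>k < \<gamma>\<close> by (simp add: q)
    moreover have "\<beta>' t * \<Psi> (x t) \<le> k * (\<beta> t * \<Psi> (x t))"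
      using mult_right_mono[OF \<beta>'_le[OF that] \<Psi>_ge[of "x t"]] by (simp add: mult.assoc)
    moreover have "\<gamma> * (\<Phi> (x t) - \<Phi> z + \<mu> / 2 * f t + \<beta> t * \<Psi> (x t)) \<le> \<gamma> * inner (G t) (x t - z)"
      using G_ge[OF that] assms(3,4) by (intro mult_left_mono) auto
    moreover have "(\<gamma> - k) * (inner q (x t - z) - \<beta> t * \<Psi> (x t)) \<le> (\<gamma> - k) * r t"
      using \<open>k < \<gamma>\<close> by (intro mult_left_mono) (auto simp: r_def)
    moreover have "0 \<le> lam * (norm (G t))\<^sup>2" using \<open>lam > 0\<close> by simp
    ultimately show ?thesis by (simp add: E'_def algebra_simps)
  qed
  have cont_x: "continuous_on {0..} x"
    using x' by (auto simp: continuous_on_eq_continuous_within intro: has_vector_derivative_continuous)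
  have cont_\<beta>: "continuous_on {0..} \<beta>"
    using \<beta>' by (auto simp: continuous_on_eq_continuous_within intro: has_vector_derivative_continuous)
  have cont_\<Psi>: "continuous_on {0..} (\<lambda>t. \<Psi> (x t))"
    using has_vector_derivative_GDERIV_compose[OF x' \<Psi>]
    by (auto simp: continuous_on_eq_continuous_within intro: has_vector_derivative_continuous)
  have f_int: "f integrable_on {0..t}" and r_int: "r integrable_on {0..t}" for t
  proof -
    have "continuous_on {0..} f" "continuous_on {0..} r"
      unfolding f_def r_def by (intro continuous_intros cont_x cont_\<beta> cont_\<Psi>)+
    then show "f integrable_on {0..t}" "r integrable_on {0..t}"
      by (auto intro!: integrable_continuous_real elim: continuous_on_subset)
  qed
  \<comment> \<open>Initial energy plus the total input from \<open>r\<close>, minus the lower bound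
    \<open>m\<close> of the potential part of \<open>E\<close>.\<close>
  define K where "K = E 0 + (\<gamma> - k) * R - m"
  have energy: "inner (w t) (w t) / 2 + \<gamma> * \<mu> / 2 * integral {0..t} f \<le> K" if "t \<ge> 0" for t
  proof -
    have "(E' has_integral (E t - E 0)) {0..t}"
      using that by (intro fundamental_theorem_of_calculus)
        (auto intro!: has_vector_derivative_within_subset[OF E'])
    moreover have "((\<lambda>s. (\<gamma> - k) * r s - \<gamma> * \<mu> / 2 * f s) has_integral
        ((\<gamma> - k) * integral {0..t} r - \<gamma> * \<mu> / 2 * integral {0..t} f)) {0..t}"
      using f_int r_int by (intro has_integral_diff has_integral_mult_right integrable_integral)
    ultimately have "E t - E 0 \<le> (\<gamma> - k) * integral {0..t} r - \<gamma> * \<mu> / 2 * integral {0..t} f"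
      by (rule has_integral_le) (use E'_le in auto)
    moreover have "(\<gamma> - k) * integral {0..t} r \<le> (\<gamma> - k) * R"
      using R[OF that] \<open>k < \<gamma>\<close> by (intro mult_left_mono) (auto simp: r_def[abs_def])
    moreover have "inner (w t) (w t) / 2 + m \<le> E t"
      using \<Phi>_ge[of "x t"] \<Psi>_ge[of "x t"] \<beta>_pos[OF that] by (simp add: E_def add_increasing2)
    ultimately show ?thesis by (simp add: K_def)
  qed
  \<comment> \<open>The constant in Young's inequality with weight \<open>\<gamma>\<close> on
    \<open>f t\<close>, chosen to cancel the term \<open>\<gamma> * f t\<close> in the expansion of
    \<open>inner (x t - z) (w t)\<close>.\<close>
  define c where "c = 1 / (4 * \<gamma>)"
  have "(f \<longlongrightarrow> 0) at_top"
  proof (rule integrable_nonneg_derivative_bounded_above_tendsto_0)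
    show "0 \<le> f t" for t by (simp add: f_def)
    fix t :: real assume t: "t \<ge> 0"
    show "(f has_vector_derivative 2 * inner (x t - z) (v t)) (at t within {0..})" by (rule f'[OF t])
    have "0 \<le> integral {0..t} f" by (intro integral_nonneg f_int) (simp add: f_def)
    then have "0 \<le> \<gamma> * \<mu> / 2 * integral {0..t} f" using assms(3-5) by simp
    then have w_bd: "inner (w t) (w t) \<le> 2 * K" using energy[OF t] by linarith
    show "integral {0..t} f \<le> K / (\<gamma> * \<mu> / 2)"
    proof -
      have "\<gamma> * \<mu> / 2 > 0" using assms(3-5) by simp
      moreover have "integral {0..t} f * (\<gamma> * \<mu> / 2) \<le> K"
        using energy[OF t] inner_ge_zero[of "w t"] by (subst mult.commute) linarith
      ultimately show ?thesis by (simp only: pos_le_divide_eq)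
    qed
    \<comment> \<open>Solving this expansion for \<open>inner (x t - z) (v t)\<close> bounds it
      above: \<open>w\<close> is bounded, and the \<open>G\<close> term is bounded below.\<close>
    have "inner (x t - z) (w t) = inner (x t - z) (v t) + \<gamma> * f t + lam * inner (G t) (x t - z)"
      by (simp only: w inner_add_right inner_scaleR_right f_def power2_norm_eq_inner inner_commute[of "G t" "x t - z"])
    moreover have "inner (x t - z) (w t) \<le> \<gamma> * f t + c * inner (w t) (w t)"
    proof -
      have "0 \<le> (norm ((2 * \<gamma>) *\<^sub>R (x t - z) - w t))\<^sup>2" by simp
      also have "\<dots> = 4 * \<gamma> * (\<gamma> * f t + c * inner (w t) (w t) - inner (x t - z) (w t))"
        unfolding f_def power2_norm_eq_inner c_def
        using assms(3,4) by (simp add: inner_diff inner_commute algebra_simps)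
      finally show ?thesis using assms(3,4) by (simp add: zero_le_mult_iff)
    qed
    moreover have "c * inner (w t) (w t) \<le> c * (2 * K)"
      using w_bd assms(3,4) by (intro mult_left_mono) (auto simp: c_def)
    moreover have "lam * (m - \<Phi> z) \<le> lam * inner (G t) (x t - z)"
    proof -
      have "0 \<le> \<mu> / 2 * f t" "0 \<le> \<beta> t * \<Psi> (x t)"
        using \<open>\<mu> > 0\<close> \<beta>_pos[OF t] \<Psi>_ge[of "x t"] by (auto simp: f_def)
      then show ?thesis
        using G_ge[OF t] \<Phi>_ge[of "x t"] \<open>lam > 0\<close> by (intro mult_left_mono) linarith+
    qed
    ultimately have "inner (x t - z) (v t) \<le> c * (2 * K) - lam * (m - \<Phi> z)"
      by argo
    then show "2 * inner (x t - z) (v t) \<le> 2 * (c * (2 * K) - lam * (m - \<Phi> z))"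
      by (rule mult_left_mono) simp
  qed
  then have "((\<lambda>t. sqrt (f t)) \<longlongrightarrow> sqrt 0) at_top" by (rule tendsto_real_sqrt)
  then have "((\<lambda>t. norm (x t - z)) \<longlongrightarrow> 0) at_top" by (simp add: f_def)
  then show ?thesis by (rule LIM_zero_cancel[OF tendsto_norm_zero_cancel])
qed

text \<open>All terms other than the second derivative are continuous in time: the velocity by
  absolute continuity, the Hessians by their Lipschitz continuity, \<open>tderiv \<beta>\<close> by
  the C1 assumption. Hence the equation extends from almost every time to every time.\<close>

lemma strong_global_solution_has_vector_derivative:
  fixes \<Phi> \<Psi> :: "'a::{real_inner, complete_space} \<Rightarrow> real"
  assumes sol: "strong_global_solution \<gamma> lam \<beta> \<Phi> \<Psi> u\<^sub>0 v\<^sub>0 x"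
    and \<Phi>: "twice_differentiable \<Phi>" "lipschitz_continuous (hessian \<Phi>)"
    and \<Psi>: "twice_differentiable \<Psi>" "lipschitz_continuous (hessian \<Psi>)"
    and \<beta>: "C1_halfline \<beta>" and "t \<ge> 0"
  shows "(tderiv x has_vector_derivative
      - (\<gamma> *\<^sub>R tderiv x t
          + lam *\<^sub>R blinfun_apply (hessian \<Phi> (x t)) (tderiv x t)
          + (lam * \<beta> t) *\<^sub>R blinfun_apply (hessian \<Psi> (x t)) (tderiv x t)
          + grad \<Phi> (x t)
          + (\<beta> t + lam * tderiv \<beta> t) *\<^sub>R grad \<Psi> (x t))) (at t within {0..})"
    (is "(_ has_vector_derivative - ?a t) _")
proof (rule abs_continuous_has_vector_derivative_everywhere[OF _ _ _ \<open>t \<ge> 0\<close>])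
  show ac: "locally_abs_continuous (tderiv x)"
    using sol by (simp add: strong_global_solution_def)
  have cont_v: "continuous_on {0..} (tderiv x)"
    unfolding continuous_on_eq_continuous_within
  proof
    fix s :: real assume "s \<in> {0..}"
    \<comment> \<open>The margin 1 makes \<open>{0..s + 1}\<close> a neighbourhood of
      \<open>s\<close> relative to the half-line, also when \<open>s = 0\<close>.\<close>
    then have "continuous_on {0..s + 1} (tderiv x)"
      using ac by (intro abs_continuous_on_interval_imp_continuous_on) (auto simp: locally_abs_continuous_def)
    then have "continuous (at s within {0..s + 1}) (tderiv x)"
      using \<open>s \<in> {0..}\<close> by (simp add: continuous_on_eq_continuous_within)
    moreover have "at s within {0..s + 1} = at s within {0..}"
      by (rule at_within_nhd[of _ "{..<s + 1}"]) auto
    ultimately show "continuous (at s within {0..}) (tderiv x)" by simp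
  qed
  have cont_x: "continuous_on {0..} x"
    using sol by (simp add: strong_global_solution_def differentiable_imp_continuous_on)
  have cont_\<beta>: "continuous_on {0..} \<beta>" "continuous_on {0..} (tderiv \<beta>)"
    using \<beta> by (simp_all add: C1_halfline_def differentiable_imp_continuous_on)
  have cont_grad: "continuous_on {0..} (\<lambda>t. grad f (x t))" if "twice_differentiable f" for f :: "'a \<Rightarrow> real"
  proof (rule continuous_on_compose2[OF _ cont_x])
    show "continuous_on UNIV (grad f)"
      using that by (intro differentiable_imp_continuous_on) (simp add: twice_differentiable_def differentiable_on_def)
  qed simp
  have cont_hessian: "continuous_on {0..} (\<lambda>t. hessian f (x t))" if "lipschitz_continuous (hessian f)" for f :: "'a \<Rightarrow> real"
  proof (rule continuous_on_compose2[OF _ cont_x])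
    show "continuous_on UNIV (hessian f)"
      using that by (auto simp: lipschitz_continuous_def intro: lipschitz_on_continuous_on)
  qed simp
  show "continuous_on {0..} (\<lambda>t. - ?a t)"
    by (intro continuous_intros cont_v cont_\<beta> cont_grad cont_hessian blinfun.continuous_on \<Phi> \<Psi>)
  show "AE t\<in>{0..} in lebesgue. (tderiv x has_vector_derivative - ?a t) (at t within {0..})"
  proof -
    have "AE t\<in>{0..} in lebesgue. tderiv x differentiable (at t within {0..}) \<and> tderiv (tderiv x) t
          + \<gamma> *\<^sub>R tderiv x t
          + lam *\<^sub>R blinfun_apply (hessian \<Phi> (x t)) (tderiv x t)
          + (lam * \<beta> t) *\<^sub>R blinfun_apply (hessian \<Psi> (x t)) (tderiv x t)
          + grad \<Phi> (x t)
          + (\<beta> t + lam * tderiv \<beta> t) *\<^sub>R grad \<Psi> (x t) = 0"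
      using sol by (simp add: strong_global_solution_def)
    then show ?thesis
    proof (rule eventually_mono, intro impI)
      fix t :: real
      assume *: "t \<in> {0..} \<longrightarrow> tderiv x differentiable (at t within {0..}) \<and> tderiv (tderiv x) t
          + \<gamma> *\<^sub>R tderiv x t
          + lam *\<^sub>R blinfun_apply (hessian \<Phi> (x t)) (tderiv x t)
          + (lam * \<beta> t) *\<^sub>R blinfun_apply (hessian \<Psi> (x t)) (tderiv x t)
          + grad \<Phi> (x t)
          + (\<beta> t + lam * tderiv \<beta> t) *\<^sub>R grad \<Psi> (x t) = 0" and "t \<in> {0..}"
      then have "tderiv (tderiv x) t = - ?a t" by (intro eq_neg_iff_add_eq_0[THEN iffD2]) (simp add: add.assoc)
      moreover have "(tderiv x has_vector_derivative tderiv (tderiv x) t) (at t within {0..})"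
        using * \<open>t \<in> {0..}\<close> vector_derivative_works unfolding tderiv_def by blast
      ultimately show "(tderiv x has_vector_derivative - ?a t) (at t within {0..})" by simp
    qed
  qed
qed

theorem theorem8:
  fixes \<Phi> \<Psi> :: "'a::{real_inner, complete_space} \<Rightarrow> real"
    and \<beta> :: "real \<Rightarrow> real"
    and \<gamma> lam k \<theta> :: real
    and u\<^sub>0 v\<^sub>0 :: 'a
    and x :: "real \<Rightarrow> 'a"
  assumes "\<gamma> > 0" and "lam > 0"
    and "\<forall>y. 0 \<le> \<Psi> y"
    and "convex_on UNIV \<Psi>" and "twice_differentiable \<Psi>"
    and "lipschitz_continuous (grad \<Psi>)" and "lipschitz_continuous (hessian \<Psi>)"
    and "argmin \<Psi> = \<Psi> -` {0}" and "argmin \<Psi> \<noteq> {}"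
    and "convex_on UNIV \<Phi>" and "twice_differentiable \<Phi>" and "bdd_below (range \<Phi>)"
    and "lipschitz_continuous (grad \<Phi>)" and "lipschitz_continuous (hessian \<Phi>)"
    and "argmin_on \<Phi> (argmin \<Psi>) \<noteq> {}"
    and "\<forall>t\<ge>0. 0 < \<beta> t" and "C1_halfline \<beta>" and "filterlim \<beta> at_top at_top"
    and "\<forall>t\<ge>0. 0 \<le> tderiv \<beta> t \<and> tderiv \<beta> t \<le> k * \<beta> t"
    and "0 < \<theta>" and "\<theta> < 1"
    and "0 < k" and "k < \<theta> / (1 + lam * \<gamma>) * min (2 * \<gamma> / 3) (2 / lam)"
    and "\<forall>p\<in>normal_cone_range (argmin \<Psi>).
           (\<integral>\<^sup>+t\<in>{0..}. e2ennreal (ereal (\<beta> t) *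
               (fenchel_conjugate \<Psi> (p /\<^sub>R \<beta> t) - support_function (argmin \<Psi>) (p /\<^sub>R \<beta> t)))
             \<partial>lebesgue) < \<infinity>"
    and "strong_global_solution \<gamma> lam \<beta> \<Phi> \<Psi> u\<^sub>0 v\<^sub>0 x"
    and "strongly_convex \<Phi>"
  shows "\<exists>z. argmin_on \<Phi> (argmin \<Psi>) = {z} \<and> (x \<longlongrightarrow> z) at_top"
proof -
  let ?C = "argmin \<Psi>"
  note sol = \<open>strong_global_solution \<gamma> lam \<beta> \<Phi> \<Psi> u\<^sub>0 v\<^sub>0 x\<close>
  \<comment> \<open>The prefactor of the minimum is at most 1, so
    \<open>k < 2 * \<gamma> / 3\<close>; this makes the divisor \<open>\<gamma> - k\<close> in
    \<open>q\<close> positive.\<close>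
  have "k < \<gamma>"
  proof -
    have "\<theta> / (1 + lam * \<gamma>) \<le> 1"
      using \<open>\<theta> < 1\<close> mult_pos_pos[OF \<open>lam > 0\<close> \<open>\<gamma> > 0\<close>] by (simp add: divide_le_eq)
    then have "\<theta> / (1 + lam * \<gamma>) * min (2 * \<gamma> / 3) (2 / lam) \<le> min (2 * \<gamma> / 3) (2 / lam)"
      using \<open>\<gamma> > 0\<close> \<open>lam > 0\<close> by (intro mult_left_le_one_le) (use \<open>0 < \<theta>\<close> in auto)
    then show ?thesis using \<open>k < \<theta> / _ * _\<close> \<open>\<gamma> > 0\<close> by linarith
  qed
  have \<Phi>: "GDERIV \<Phi> y :> grad \<Phi> y" and \<Psi>: "GDERIV \<Psi> y :> grad \<Psi> y" for y
    using \<open>twice_differentiable \<Phi>\<close> \<open>twice_differentiable \<Psi>\<close>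
    by (auto simp: twice_differentiable_def intro!: GDERIV_grad)
  have x': "(x has_vector_derivative tderiv x t) (at t within {0..})" if "t \<ge> 0" for t
    using sol that unfolding tderiv_def
    by (simp add: strong_global_solution_def differentiable_on_def flip: vector_derivative_works)
  have \<beta>': "(\<beta> has_vector_derivative tderiv \<beta> t) (at t within {0..})" if "t \<ge> 0" for t
    using \<open>C1_halfline \<beta>\<close> that unfolding tderiv_def
    by (simp add: C1_halfline_def differentiable_on_def flip: vector_derivative_works)
  \<comment> \<open>At a convex combination of zeros, \<open>\<Psi>\<close> is at most 0, hence
    equal to 0.\<close>
  have "convex ?C"
    unfolding \<open>?C = \<Psi> -` {0}\<close>
  proof (rule convexI)
    fix y u and a b :: real
    assume "y \<in> \<Psi> -` {0}" "u \<in> \<Psi> -` {0}" "0 \<le> a" "0 \<le> b" "a + b = 1"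
    then have "\<Psi> (a *\<^sub>R y + b *\<^sub>R u) \<le> a * \<Psi> y + b * \<Psi> u"
      using \<open>convex_on UNIV \<Psi>\<close> unfolding convex_on_def by blast
    then show "a *\<^sub>R y + b *\<^sub>R u \<in> \<Psi> -` {0}"
      using \<open>\<forall>y. 0 \<le> \<Psi> y\<close> \<open>y \<in> _\<close> \<open>u \<in> _\<close> by (simp add: antisym)
  qed
  obtain m where m: "\<And>y. m \<le> \<Phi> y" using \<open>bdd_below (range \<Phi>)\<close> by (auto simp: bdd_below_def)
  obtain \<mu> where "\<mu> > 0" and
    \<mu>: "\<And>y u g. GDERIV \<Phi> y :> g \<Longrightarrow> \<Phi> y + inner g (u - y) + \<mu> / 2 * (norm (y - u))\<^sup>2 \<le> \<Phi> u"
    using strongly_convexE[OF \<open>strongly_convex \<Phi>\<close>] by blast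
  have conv: "(x \<longlongrightarrow> z) at_top" if z: "z \<in> argmin_on \<Phi> ?C" for z
  proof -
    define q where "q = - ((\<gamma> / (\<gamma> - k)) *\<^sub>R grad \<Phi> z)"
    have "z \<in> ?C" "\<And>y. y \<in> ?C \<Longrightarrow> \<Phi> z \<le> \<Phi> y" using z by (auto simp: argmin_on_def)
    then have q: "q \<in> normal_cone ?C z"
      unfolding q_def using \<open>convex ?C\<close> \<Phi> \<open>k < \<gamma>\<close> \<open>\<gamma> > 0\<close>
      by (intro minimizer_on_convex_imp_normal_cone[where f = \<Phi>]) auto
    define r where "r s = max 0 (inner q (x s - z) - \<beta> s * \<Psi> (x s))" for s
    \<comment> \<open>The excess inequality is used at the point \<open>x t\<close> with scale
      \<open>\<beta> t\<close>; the indicator restricts it to \<open>t \<ge> 0\<close>, where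
      \<open>\<beta>\<close> is positive.\<close>
    have "(\<integral>\<^sup>+t\<in>{0..}. ennreal (r t) \<partial>lebesgue) \<le> (\<integral>\<^sup>+t\<in>{0..}. e2ennreal (ereal (\<beta> t) *
               (fenchel_conjugate \<Psi> (q /\<^sub>R \<beta> t) - support_function ?C (q /\<^sub>R \<beta> t))) \<partial>lebesgue)"
      unfolding r_def using normal_cone_excess_ge[OF q] \<open>\<forall>t\<ge>0. 0 < \<beta> t\<close>
      by (intro nn_integral_mono) (auto simp: indicator_def)
    also have "\<dots> < \<infinity>" using assms(24) q by (auto simp: normal_cone_range_def)
    finally have r_fin: "(\<integral>\<^sup>+t\<in>{0..}. ennreal (r t) \<partial>lebesgue) < \<infinity>" .
    have "continuous_on {0..} x" "continuous_on {0..} \<beta>" "continuous_on {0..} (\<lambda>t. \<Psi> (x t))"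
      using x' \<beta>' has_vector_derivative_GDERIV_compose[OF x' \<Psi>]
      by (auto simp: continuous_on_eq_continuous_within intro: has_vector_derivative_continuous)
    then have "continuous_on {0..} r" unfolding r_def by (intro continuous_intros)
    moreover have "0 \<le> r t" for t by (simp add: r_def)
    ultimately obtain R where R: "\<And>t. t \<ge> 0 \<Longrightarrow> integral {0..t} r \<le> R"
      using bounded_nn_integral_imp_bounded_integrals[OF _ _ r_fin] by blast
    define G where "G t = grad \<Phi> (x t) + \<beta> t *\<^sub>R grad \<Psi> (x t)" for t
    define w where "w t = tderiv x t + \<gamma> *\<^sub>R (x t - z) + lam *\<^sub>R G t" for t
    \<comment> \<open>Differentiating \<open>lam *\<^sub>R G\<close> produces both Hessian terms and
      the term with \<open>lam * tderiv \<beta> t\<close>. These cancel against the equation, as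
      does the damping, leaving \<open>- G\<close>.\<close>
    have w': "(w has_vector_derivative - G t) (at t within {0..})" if t: "t \<ge> 0" for t
    proof -
      have "((\<lambda>s. grad \<Phi> (x s)) has_vector_derivative hessian \<Phi> (x t) (tderiv x t)) (at t within {0..})"
        "((\<lambda>s. grad \<Psi> (x s)) has_vector_derivative hessian \<Psi> (x t) (tderiv x t)) (at t within {0..})"
        using \<open>twice_differentiable \<Phi>\<close> \<open>twice_differentiable \<Psi>\<close>
        by (auto simp: twice_differentiable_def intro!: has_vector_derivative_grad_compose x' t)
      note D = this strong_global_solution_has_vector_derivative[OF sol \<open>twice_differentiable \<Phi>\<close>
          \<open>lipschitz_continuous (hessian \<Phi>)\<close> \<open>twice_differentiable \<Psi>\<close>
          \<open>lipschitz_continuous (hessian \<Psi>)\<close> \<open>C1_halfline \<beta>\<close> t]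
      show ?thesis
        unfolding w_def G_def
        by (rule derivative_eq_intros D x'[OF t] refl
            bounded_bilinear.has_vector_derivative[OF bounded_bilinear_scaleR \<beta>'[OF t]])+
          (simp add: algebra_simps)
    qed
    show ?thesis
    proof (rule first_order_system_convergence[where \<Phi> = \<Phi> and \<Psi> = \<Psi> and \<beta> = \<beta> and \<beta>' = "tderiv \<beta>"
          and v = "tderiv x" and w = w and \<gamma> = \<gamma> and lam = lam and k = k and \<mu> = \<mu> and m = m and R = R])
      show "lam > 0" "k < \<gamma>" "\<mu> > 0" by fact+
      show "0 \<le> k" using \<open>0 < k\<close> by simp
      show "GDERIV \<Phi> y :> grad \<Phi> y" "GDERIV \<Psi> y :> grad \<Psi> y" "m \<le> \<Phi> y" for y by (fact \<Phi> \<Psi> m)+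
      show "0 \<le> \<Psi> y" for y using \<open>\<forall>y. 0 \<le> \<Psi> y\<close> by simp
      show "\<Psi> z = 0" using \<open>z \<in> ?C\<close> \<open>?C = \<Psi> -` {0}\<close> by auto
      show "\<Phi> y + inner (grad \<Phi> y) (u - y) + \<mu> / 2 * (norm (y - u))\<^sup>2 \<le> \<Phi> u" for y u
        using \<Phi> by (rule \<mu>)
      show "\<Psi> y + inner (grad \<Psi> y) (u - y) \<le> \<Psi> u" for y u
        using \<open>convex_on UNIV \<Psi>\<close> \<Psi> by (rule convex_gradient_inequality)
      show "w t = tderiv x t + \<gamma> *\<^sub>R (x t - z) + lam *\<^sub>R (grad \<Phi> (x t) + \<beta> t *\<^sub>R grad \<Psi> (x t))" for t
        by (simp add: w_def G_def)
      show "q = - ((\<gamma> / (\<gamma> - k)) *\<^sub>R grad \<Phi> z)" by (fact q_def)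
      fix t :: real assume t: "t \<ge> 0"
      show "0 < \<beta> t" "tderiv \<beta> t \<le> k * \<beta> t"
        using t \<open>\<forall>t\<ge>0. 0 < \<beta> t\<close> \<open>\<forall>t\<ge>0. _ \<and> tderiv \<beta> t \<le> k * \<beta> t\<close> by auto
      show "(\<beta> has_vector_derivative tderiv \<beta> t) (at t within {0..})"
        "(x has_vector_derivative tderiv x t) (at t within {0..})"
        using t by (rule \<beta>' x')+
      show "(w has_vector_derivative - (grad \<Phi> (x t) + \<beta> t *\<^sub>R grad \<Psi> (x t))) (at t within {0..})"
        using w'[OF t] by (simp only: G_def)
      show "integral {0..t} (\<lambda>s. max 0 (inner q (x s - z) - \<beta> s * \<Psi> (x s))) \<le> R"
        using R[OF t] by (simp add: r_def[abs_def])
    qed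
  qed
  \<comment> \<open>Every element of the solution set is a limit of the same trajectory, so the
    nonempty set is a singleton.\<close>
  then show ?thesis
    using \<open>argmin_on \<Phi> ?C \<noteq> {}\<close> tendsto_unique[of at_top x] trivial_limit_at_top_linorder by blast
qed

end
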